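(* Let $p,q,r\ge0$ be integers, let $m_1,\ldots,m_r$ be positive integers, and put $m:=m_1+\cdots+m_r$. Let $\alpha_1,\ldots,\alpha_p$, $\beta_1,\ldots,\beta_q$, $a,b,c,f_1,\ldots,f_r$ be complex numbers such that none of $\beta_1,\dots,\beta_q,c,f_1,\ldots,f_r$ is a non-positive integer. Assume $(c-a-m)_m\ne0$, $(c-b-m)_m\ne0$ and that the polynomial $\hat Q_m(t)$ (defined in the context from $a,b,c,(f_j),(m_j)$) has degree $m$; let $\eta_1,\ldots,\eta_m$ be its zeros counted with multiplicity (all nonzero, since $\hat Q_m(0)=1$). Then, for every complex $x$ for which the double series on the left converges absolutely, $$ F^{p:\,r+2;\,1}_{\,q:\,r+1;\,0}\left[\left.\begin{array}{c}(\alpha_p):\ a,\ b,\ (f_r+m_r);\ c-a-b-m\\ (\beta_q):\ c,\ (f_r);\ -\end{array}\right|x,\ x\right] ={}_{p+m+2}F_{q+m+1}\left[\begin{array}{c}\alpha_1,\ldots,\alpha_p,\ c-a-m,\ c-b-m,\ \eta_1+1,\ldots,\eta_m+1\\ \beta_1,\ldots,\beta_q,\ c,\ \eta_1,\ldots,\eta_m\end{array};x\right]. $$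
   Context: Notation. $(x)_k$ is the Pochhammer symbol: $(x)_0=1$, $(x)_k=x(x+1)\cdots(x+k-1)$ for $k\ge1$. A finite parameter sequence $a_1,\ldots,a_p$ is abbreviated $(a_p)$, and $((a_p))_k:=(a_1)_k\cdots(a_p)_k$; $(f_r+m_r)$ denotes $f_1+m_1,\ldots,f_r+m_r$. Empty products equal $1$, empty parameter lists are allowed, and a dash denotes an empty parameter list. The generalized hypergeometric series is $${}_pF_q\left[\begin{array}{c}a_1,\ldots,a_p\\ b_1,\ldots,b_q\end{array};z\right]=\sum_{k\ge0}\frac{(a_1)_k\cdots(a_p)_k}{(b_1)_k\cdots(b_q)_k}\frac{z^k}{k!}.$$ The Kamp\'e de F\'eriet function of two variables is $$F^{p:\,r;\,s}_{\,q:\,t;\,u}\left[\left.\begin{array}{c}(\alpha_p):\,(a_r);\,(b_s)\\(\beta_q):\,(c_t);\,(d_u)\end{array}\right|x,\,y\right]=\sum_{k=0}^\infty\sum_{l=0}^\infty\frac{((\alpha_p))_{k+l}}{((\beta_q))_{k+l}}\,\frac{((a_r))_k((b_s))_l}{((c_t))_k((d_u))_l}\,\frac{x^ky^l}{k!\,l!}.$$ Thus the left-hand side of the claim is $$\sum_{k,l\ge0}\frac{((\alpha_p))_{k+l}}{((\beta_q))_{k+l}}\frac{(a)_k(b)_k((f_r+m_r))_k\,(c-a-b-m)_l}{(c)_k((f_r))_k}\frac{x^{k+l}}{k!\,l!}.$$ Coefficients $C_{k,r}$. Let $\Lambda=(f_1)_{m_1}\cdots(f_r)_{m_r}$ and define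 $\sigma_0,\ldots,\sigma_m$ by the polynomial identity $(f_1+x)_{m_1}\cdots(f_r+x)_{m_r}=\sum_{j=0}^m\sigma_jx^j$. For $0\le k\le m$ set $C_{k,r}=\frac1\Lambda\sum_{j=k}^m\sigma_j\,\mathbf S_j^{(k)}$, where $\mathbf S_j^{(k)}$ is the Stirling number of the second kind. Polynomial $\hat Q_m$. For $0\le k\le m$ put $$G_{m,k}(t)={}_3F_2\left[\begin{array}{c}-m+k,\ t+k,\ c-a-b-m\\ c-a-m+k,\ c-b-m+k\end{array};1\right],$$ a finite sum over indices $0,\ldots,m-k$, hence a polynomial in $t$, and $$\hat Q_m(t)=\sum_{k=0}^m\frac{(-1)^kC_{k,r}\,(a)_k(b)_k(t)_k}{(c-a-m)_k(c-b-m)_k}\,G_{m,k}(t).$$ It satisfies $\hat Q_m(0)=1$. Convention: in the series with parameters $\eta_j+1$ over $\eta_j$, each quotient $(\eta_j+1)_k/(\eta_j)_k$ is understood as $(\eta_j+k)/\eta_j$. *)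

theory Defs
  imports
    "HOL-Analysis.Analysis"
    "HOL-Computational_Algebra.Computational_Algebra"
    "HOL-Combinatorics.Stirling"
    "HOL-Library.Nonpos_Ints"
begin

text \<open>Parameter sequences are lists, so the integers p, q, r are list lengths and empty
  parameter lists are covered.\<close>

definition pochs :: "complex list \<Rightarrow> nat \<Rightarrow> complex" where
  "pochs as k = (\<Prod>a\<leftarrow>as. pochhammer a k)"

definition hyp_term :: "complex list \<Rightarrow> complex list \<Rightarrow> complex \<Rightarrow> nat \<Rightarrow> complex" where
  "hyp_term as bs z k = pochs as k / pochs bs k * (z ^ k / fact k)"

definition pFq :: "complex list \<Rightarrow> complex list \<Rightarrow> complex \<Rightarrow> complex" where
  "pFq as bs z = (\<Sum>k. hyp_term as bs z k)"

text \<open>The series with additional numerator parameters \<open>\<eta>\<^sub>j + 1\<close> and denominator parameters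
  \<open>\<eta>\<^sub>j\<close>, where each quotient of Pochhammer symbols is read as \<open>(\<eta>\<^sub>j + k) / \<eta>\<^sub>j\<close>. This reading is
  needed when some \<open>\<eta>\<^sub>j\<close> is a negative integer; lemma \<open>pFq_shift_eq_pFq\<close> below gives
  the agreement with \<open>pFq\<close> otherwise.\<close>

definition hyp_shift_term ::
    "complex list \<Rightarrow> complex list \<Rightarrow> complex list \<Rightarrow> complex \<Rightarrow> nat \<Rightarrow> complex" where
  "hyp_shift_term as bs \<eta>s z k =
     pochs as k / pochs bs k * (\<Prod>\<eta>\<leftarrow>\<eta>s. (\<eta> + of_nat k) / \<eta>) * (z ^ k / fact k)"

definition pFq_shift ::
    "complex list \<Rightarrow> complex list \<Rightarrow> complex list \<Rightarrow> complex \<Rightarrow> complex" where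
  "pFq_shift as bs \<eta>s z = (\<Sum>k. hyp_shift_term as bs \<eta>s z k)"

text \<open>The argument order of the Kampe de Feriet function is
  \<open>(\<alpha>\<^sub>p) : (a\<^sub>r) ; (b\<^sub>s)\<close> over \<open>(\<beta>\<^sub>q) : (c\<^sub>t) ; (d\<^sub>u)\<close>, then the variables.\<close>

definition kdf_term ::
    "complex list \<Rightarrow> complex list \<Rightarrow> complex list \<Rightarrow>
     complex list \<Rightarrow> complex list \<Rightarrow> complex list \<Rightarrow>
     complex \<Rightarrow> complex \<Rightarrow> nat \<Rightarrow> nat \<Rightarrow> complex" where
  "kdf_term \<alpha>s as bs \<beta>s cs ds x y k l =
     pochs \<alpha>s (k + l) / pochs \<beta>s (k + l) *
     ((pochs as k * pochs bs l) / (pochs cs k * pochs ds l)) *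
     (x ^ k * y ^ l / (fact k * fact l))"

definition kampe_de_feriet ::
    "complex list \<Rightarrow> complex list \<Rightarrow> complex list \<Rightarrow>
     complex list \<Rightarrow> complex list \<Rightarrow> complex list \<Rightarrow>
     complex \<Rightarrow> complex \<Rightarrow> complex" where
  "kampe_de_feriet \<alpha>s as bs \<beta>s cs ds x y =
     (\<Sum>k. \<Sum>l. kdf_term \<alpha>s as bs \<beta>s cs ds x y k l)"

definition kdf_abs_convergent ::
    "complex list \<Rightarrow> complex list \<Rightarrow> complex list \<Rightarrow>
     complex list \<Rightarrow> complex list \<Rightarrow> complex list \<Rightarrow>
     complex \<Rightarrow> complex \<Rightarrow> bool" where
  "kdf_abs_convergent \<alpha>s as bs \<beta>s cs ds x y \<longleftrightarrow>
     (\<lambda>(k, l). norm (kdf_term \<alpha>s as bs \<beta>s cs ds x y k l)) summable_on UNIV"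

definition shift_params :: "complex list \<Rightarrow> nat list \<Rightarrow> complex list" where
  "shift_params fs ms = map2 (\<lambda>f m. f + of_nat m) fs ms"

definition Lambda :: "complex list \<Rightarrow> nat list \<Rightarrow> complex" where
  "Lambda fs ms = (\<Prod>(f, m)\<leftarrow>zip fs ms. pochhammer f m)"

text \<open>\<open>\<sigma>\<^sub>j\<close> is the coefficient of \<open>x\<^sup>j\<close> in the product of the \<open>(f\<^sub>i + x)\<close> to the rising power \<open>m\<^sub>i\<close>;
  note that \<open>[:f, 1:]\<close> is the polynomial \<open>f + x\<close>.\<close>

definition sigma :: "complex list \<Rightarrow> nat list \<Rightarrow> nat \<Rightarrow> complex" where
  "sigma fs ms j = coeff (\<Prod>(f, m)\<leftarrow>zip fs ms. pochhammer [:f, 1:] m) j"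

definition C_coeff :: "complex list \<Rightarrow> nat list \<Rightarrow> nat \<Rightarrow> complex" where
  "C_coeff fs ms k =
     1 / Lambda fs ms * (\<Sum>j = k..sum_list ms. sigma fs ms j * of_nat (Stirling j k))"

text \<open>\<open>G_poly\<close> and \<open>Q_hat\<close> are polynomials in the variable \<open>t = [:0, 1:]\<close>. Lemmas \<open>poly_G_poly\<close>
  and \<open>poly_Q_hat\<close> below express their values through the series \<open>pFq\<close>.\<close>

definition G_poly :: "complex \<Rightarrow> complex \<Rightarrow> complex \<Rightarrow> nat \<Rightarrow> nat \<Rightarrow> complex poly" where
  "G_poly a b c m k =
     (\<Sum>i\<le>m - k.
        smult (pochhammer (- of_nat m + of_nat k) i * pochhammer (c - a - b - of_nat m) i /
               (pochhammer (c - a - of_nat m + of_nat k) i *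
                pochhammer (c - b - of_nat m + of_nat k) i * fact i))
          (pochhammer [:of_nat k, 1:] i))"

definition Q_hat ::
    "complex list \<Rightarrow> nat list \<Rightarrow> complex \<Rightarrow> complex \<Rightarrow> complex \<Rightarrow> complex poly" where
  "Q_hat fs ms a b c = (let m = sum_list ms in
     \<Sum>k\<le>m.
        smult ((- 1) ^ k * C_coeff fs ms k * pochhammer a k * pochhammer b k /
               (pochhammer (c - a - of_nat m) k * pochhammer (c - b - of_nat m) k))
          (pochhammer [:0, 1:] k * G_poly a b c m k))"

lemma hyp_term_eq_fps_hypergeo: "hyp_term as bs z k = fps_nth (fps_hypergeo as bs z) k"
proof -
  have *: "foldl (\<lambda>r a. r * pochhammer a k) s xs = s * pochs xs k" for xs and s :: complex
    by (induction xs arbitrary: s) (simp_all add: pochs_def mult.assoc)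
  show ?thesis by (simp add: hyp_term_def *)
qed

lemma pFq_shift_eq_pFq:
  assumes "\<forall>\<eta>\<in>set \<eta>s. \<eta> \<notin> \<int>\<^sub>\<le>\<^sub>0"
  shows "pFq_shift as bs \<eta>s z = pFq (as @ map (\<lambda>\<eta>. \<eta> + 1) \<eta>s) (bs @ \<eta>s) z"
proof -
  have quot: "(\<eta> + of_nat k) / \<eta> = pochhammer (\<eta> + 1) k / pochhammer \<eta> k"
    if "\<eta> \<notin> \<int>\<^sub>\<le>\<^sub>0" for \<eta> :: complex and k
  proof -
    have "\<eta> \<noteq> 0" using that by auto
    moreover have "pochhammer \<eta> k \<noteq> 0"
      using that by (auto simp: pochhammer_eq_0_iff)
    moreover have "pochhammer \<eta> k * (\<eta> + of_nat k) = \<eta> * pochhammer (\<eta> + 1) k"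
      by (metis pochhammer_Suc pochhammer_rec)
    ultimately show ?thesis by (simp add: field_simps)
  qed
  have "(\<Prod>\<eta>\<leftarrow>\<eta>s. (\<eta> + of_nat k) / \<eta>) = pochs (map (\<lambda>\<eta>. \<eta> + 1) \<eta>s) k / pochs \<eta>s k" for k
    using assms by (induction \<eta>s) (simp_all add: pochs_def quot)
  then have "hyp_shift_term as bs \<eta>s z k = hyp_term (as @ map (\<lambda>\<eta>. \<eta> + 1) \<eta>s) (bs @ \<eta>s) z k" for k
    by (simp add: hyp_shift_term_def hyp_term_def pochs_def)
  then show ?thesis by (simp add: pFq_shift_def pFq_def)
qed

lemma poly_pochhammer_poly: "poly (pochhammer p n) t = pochhammer (poly p t) n"
  for p :: "complex poly"
  by (induction n) (simp_all add: pochhammer_Suc of_nat_poly)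

lemma poly_G_poly:
  assumes "k \<le> m"
  shows "poly (G_poly a b c m k) t =
    pFq [- of_nat m + of_nat k, t + of_nat k, c - a - b - of_nat m]
        [c - a - of_nat m + of_nat k, c - b - of_nat m + of_nat k] 1"
proof -
  let ?h = "hyp_term [- of_nat m + of_nat k, t + of_nat k, c - a - b - of_nat m]
        [c - a - of_nat m + of_nat k, c - b - of_nat m + of_nat k] 1"
  have neg: "- of_nat m + of_nat k = - (of_nat (m - k) :: complex)"
    using assms by (simp add: of_nat_diff)
  have "?h i = 0" if "i \<notin> {..m - k}" for i
  proof -
    have "pochhammer (- (of_nat (m - k) :: complex)) i = 0"
      using that by (intro pochhammer_of_nat_eq_0_lemma) simp
    then show ?thesis unfolding hyp_term_def pochs_def neg by simp
  qed
  then have "(\<Sum>i. ?h i) = (\<Sum>i\<le>m - k. ?h i)"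
    by (intro suminf_finite) auto
  also have "\<dots> = poly (G_poly a b c m k) t"
    unfolding G_poly_def poly_sum
    by (intro sum.cong refl)
       (simp add: hyp_term_def pochs_def poly_pochhammer_poly add.commute[of t])
  finally show ?thesis by (simp add: pFq_def)
qed

lemma poly_Q_hat:
  assumes "m = sum_list ms"
  shows "poly (Q_hat fs ms a b c) t =
    (\<Sum>k\<le>m. (- 1) ^ k * C_coeff fs ms k * pochhammer a k * pochhammer b k * pochhammer t k /
            (pochhammer (c - a - of_nat m) k * pochhammer (c - b - of_nat m) k) *
       pFq [- of_nat m + of_nat k, t + of_nat k, c - a - b - of_nat m]
           [c - a - of_nat m + of_nat k, c - b - of_nat m + of_nat k] 1)"
  unfolding Q_hat_def Let_def poly_sum assms[symmetric]
  by (intro sum.cong refl) (simp add: poly_G_poly poly_pochhammer_poly)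

end

theory Submission
  imports Defs
begin

text \<open>Collecting the terms with \<open>k + l = N\<close> reduces the theorem to a finite identity for each \<open>N\<close>.
  The quotient \<open>((f\<^sub>r + m\<^sub>r))\<^sub>k / ((f\<^sub>r))\<^sub>k\<close> is a polynomial in \<open>k\<close>, and its coefficients with respect to
  the falling factorials \<open>k (k - 1) \<dots> (k - i + 1)\<close> are the \<open>C\<^sub>i\<^sub>,\<^sub>r\<close>. For each \<open>i\<close>, Sheppard's transformation
  of terminating \<open>\<^sub>3F\<^sub>2\<close> series turns the sum over \<open>k\<close> into \<open>(c - a - m)\<^sub>N (c - b - m)\<^sub>N\<close> times the \<open>i\<close>-th
  summand of the polynomial \<open>Q_hat\<close> at \<open>-N\<close>, and \<open>Q_hat(-N) = \<Prod>(\<eta>\<^sub>j + N) / \<eta>\<^sub>j\<close> because \<open>Q_hat(0) = 1\<close>.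
  Sheppard's transformation is used in a division-free form, which follows from the Pfaff-Saalschuetz
  identity by expanding in falling factorials of one parameter.\<close>

section \<open>Division-free Pfaff-Saalschuetz and Sheppard identities\<close>

text \<open>With C = A + B + D this is the balanced 3F2(-L, A, B; C, 1 - D - L; 1), multiplied by
  (C)_L (D)_L to clear denominators; hence it makes sense in every commutative ring. The right-hand
  side gains the factor \<open>K\<close> when L grows by one, and the sum does so too because the
  defect of each summand telescopes.\<close>

lemma pochhammer_Saalschuetz:
  fixes A B D :: "'a::comm_ring_1"
  shows "(\<Sum>k\<le>L. of_nat (L choose k) * pochhammer A k * pochhammer B k *
            pochhammer D (L - k) * pochhammer (A + B + D + of_nat k) (L - k)) =
         pochhammer (A + D) L * pochhammer (B + D) L"
proof (induction L)
  case 0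
  show ?case by simp
next
  case (Suc L)
  define f where "f = (\<lambda>L k. of_nat (L choose k) * pochhammer A k * pochhammer B k *
    pochhammer D (L - k) * pochhammer (A + B + D + of_nat k) (L - k))"
  define h where "h = (\<lambda>j. of_nat (L choose j) * pochhammer A (Suc j) * pochhammer B (Suc j) *
    pochhammer D (L - j) * pochhammer (A + B + D + of_nat j) (L - j))"
  \<comment> \<open>\<open>g\<close> is the Wilf-Zeilberger certificate of the recurrence \<open>F (Suc L) = K * F L\<close> of the sum.\<close>
  define g where "g = (\<lambda>k. case k of 0 \<Rightarrow> 0 | Suc j \<Rightarrow> h j)"
  define K where "K = (A + D + of_nat L) * (B + D + of_nat L)"
  have step: "f (Suc L) k = K * f L k + (g k - g (Suc k))" if "k \<le> L" for k
  proof -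
    define E where "E = L - k"
    have L: "of_nat L = (of_nat k + of_nat E :: 'a)" and SL: "Suc L - k = Suc E"
      using that by (auto simp: E_def Suc_diff_le simp flip: of_nat_add)
    \<comment> \<open>Factoring out \<open>P\<close> turns the recurrence into an identity between
      polynomials in A, B, D, k, E and a few binomial coefficients.\<close>
    define P where "P = pochhammer A k * pochhammer B k * pochhammer D E *
      pochhammer (A + B + D + of_nat k) E"
    have fL: "f L k = of_nat (L choose k) * P"
      by (simp add: f_def P_def E_def mult_ac)
    have fSL: "f (Suc L) k = of_nat (Suc L choose k) * ((D + of_nat E) * (A + B + D + of_nat k + of_nat E) * P)"
      unfolding f_def SL P_def by (simp only: pochhammer_rec' mult_ac)
    have gS: "g (Suc k) = of_nat (L choose k) * ((A + of_nat k) * (B + of_nat k) * P)"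
      unfolding g_def h_def P_def E_def by (simp add: pochhammer_rec' mult_ac)
    show ?thesis
    proof (cases k)
      case 0
      then show ?thesis
        unfolding fL fSL gS K_def L by (simp add: g_def algebra_simps)
    next
      case (Suc j)
      have Lj: "L - j = Suc E"
        using that Suc by (simp add: E_def)
      define u v where "u = (of_nat (L choose k) :: 'a)" and "v = (of_nat (L choose j) :: 'a)"
      have "Suc E * (L choose j) = k * (L choose k)"
        using binomial_absorb_comp[of L j] binomial_absorption[of j L] Lj Suc by simp
      then have uv: "(of_nat E + 1) * v = of_nat k * u"
        unfolding u_def v_def by (metis of_nat_Suc of_nat_mult add.commute)
      have gk: "g k = v * ((D + of_nat E) * (A + B + D + of_nat k - 1) * P)"
      proof -
        have "pochhammer (A + B + D + of_nat j) (Suc E)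
              = (A + B + D + of_nat k - 1) * pochhammer (A + B + D + of_nat k) E"
          by (simp add: pochhammer_rec Suc add_ac)
        then show ?thesis
          unfolding g_def h_def P_def v_def Suc nat.case using Lj Suc
          by (simp add: pochhammer_rec' mult_ac)
      qed
      \<comment> \<open>By Pascal's rule \<open>Suc L choose k\<close> is u + v, and what remains is
        a multiple of the relation \<open>uv\<close> between neighbouring binomial
        coefficients.\<close>
      have "f (Suc L) k - K * f L k - g k + g (Suc k)
            = (D + of_nat E) * P * ((of_nat E + 1) * v - of_nat k * u)"
        unfolding fL fSL gS gk K_def L u_def[symmetric]
        by (simp add: Suc u_def v_def algebra_simps)
      then have "f (Suc L) k - K * f L k - g k + g (Suc k) = 0"
        by (simp only: uv diff_self mult_zero_right)
      then show ?thesis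
        by (simp add: algebra_simps add_eq_0_iff)
    qed
  qed
  \<comment> \<open>\<open>step\<close> covers only k \<le> L; the top summand, k = L + 1, is
    exactly \<open>h L\<close> and cancels the boundary term -\<open>h L\<close> of the telescoping
    sum.\<close>
  have "(\<Sum>k\<le>Suc L. f (Suc L) k) = (\<Sum>k\<le>L. f (Suc L) k) + h L"
    by (simp add: f_def h_def)
  also have "(\<Sum>k\<le>L. f (Suc L) k) = K * (\<Sum>k\<le>L. f L k) + (\<Sum>k<Suc L. g k - g (Suc k))"
    by (simp add: step sum.distrib sum_distrib_left lessThan_Suc_atMost)
  also have "(\<Sum>k<Suc L. g k - g (Suc k)) = - h L"
    by (subst sum_lessThan_telescope') (simp add: g_def)
  also have "(\<Sum>k\<le>L. f L k) = pochhammer (A + D) L * pochhammer (B + D) L"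
    using Suc.IH by (simp add: f_def)
  finally show ?case
    by (simp add: f_def K_def pochhammer_rec' mult_ac)
qed

text \<open>The factor (-1)^j (-x)_j is the falling factorial x (x - 1) ... (x - j + 1). The
  expansion is Vandermonde's rule for rising factorials, applied after the reflection (z)_n = (-1)^n
  (1 - z - n)_n, which reverses the order of the factors.\<close>

lemma pochhammer_add_falling:
  fixes x y :: "'a::comm_ring_1"
  shows "pochhammer (y + x) n =
    (\<Sum>j\<le>n. of_nat (n choose j) * ((- 1) ^ j * pochhammer (- x) j) * pochhammer (y + of_nat j) (n - j))"
proof -
  have reflect: "pochhammer (1 - y - of_nat n) (n - j) = (- 1) ^ (n - j) * pochhammer (y + of_nat j) (n - j)"
    if "j \<le> n" for j
  proof -
    have "y + of_nat n - 1 - of_nat (n - j) + 1 = y + of_nat j"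
      using that by (simp add: of_nat_diff)
    then show ?thesis
      using pochhammer_minus[of "y + of_nat n - 1" "n - j"] by (simp add: algebra_simps)
  qed
  have "pochhammer (y + x) n = (- 1) ^ n * pochhammer (- x + (1 - y - of_nat n)) n"
    using pochhammer_minus[of "x + y + of_nat n - 1" n]
    by (simp add: algebra_simps flip: power_mult_distrib mult.assoc)
  also have "\<dots> = (\<Sum>j\<le>n. (- 1) ^ n * (of_nat (n choose j) * pochhammer (- x) j *
      ((- 1) ^ (n - j) * pochhammer (y + of_nat j) (n - j))))"
    by (subst pochhammer_binomial_sum) (simp add: reflect sum_distrib_left)
  also have "\<dots> = (\<Sum>j\<le>n. of_nat (n choose j) * ((- 1) ^ j * pochhammer (- x) j) *
      pochhammer (y + of_nat j) (n - j))"
  proof (intro sum.cong refl)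
    fix j assume "j \<in> {..n}"
    then obtain i where i: "n = j + i" by (auto simp: le_iff_add)
    have "(- 1) ^ n * (- 1) ^ (n - j) = ((- 1) ^ j :: 'a)"
      by (simp add: i power_add mult.assoc flip: power_mult_distrib)
    from arg_cong[OF this, of "\<lambda>s. s * (of_nat (n choose j) * pochhammer (- x) j *
      pochhammer (y + of_nat j) (n - j))"]
    show "(- 1) ^ n * (of_nat (n choose j) * pochhammer (- x) j *
      ((- 1) ^ (n - j) * pochhammer (y + of_nat j) (n - j))) =
      of_nat (n choose j) * ((- 1) ^ j * pochhammer (- x) j) * pochhammer (y + of_nat j) (n - j)"
      by (simp only: ac_simps)
  qed
  finally show ?thesis .
qed

text \<open>Here x measures the deviation from the balanced case x = 0. Expanding the last
  Pochhammer symbol in falling factorials of x and exchanging the sums leaves, as the coefficient of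
  each falling factorial, a sum that Pfaff-Saalschuetz evaluates.\<close>

lemma pochhammer_Sheppard:
  fixes A B d x :: "'a::comm_ring_1"
  shows "(\<Sum>k\<le>M. of_nat (M choose k) * pochhammer A k * pochhammer B k *
            pochhammer d (M - k) * pochhammer (A + B + d + x + of_nat k) (M - k)) =
         (\<Sum>i\<le>M. of_nat (M choose i) * ((- 1) ^ i * pochhammer (- x) i) * pochhammer d i *
            pochhammer (B + d + of_nat i) (M - i) * pochhammer (A + d + of_nat i) (M - i))"
proof -
  let ?t = "\<lambda>k i. of_nat (M choose k) * pochhammer A k * pochhammer B k * pochhammer d (M - k) *
      (of_nat (M - k choose i) * ((- 1) ^ i * pochhammer (- x) i) *
        pochhammer (A + B + d + of_nat k + of_nat i) (M - k - i))"
  have "(\<Sum>k\<le>M. of_nat (M choose k) * pochhammer A k * pochhammer B k *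
            pochhammer d (M - k) * pochhammer (A + B + d + x + of_nat k) (M - k)) =
        (\<Sum>k\<le>M. \<Sum>i\<le>M - k. ?t k i)"
  proof (intro sum.cong refl)
    fix k
    have "A + B + d + x + of_nat k = (A + B + d + of_nat k) + x" by (simp add: add_ac)
    then show "of_nat (M choose k) * pochhammer A k * pochhammer B k *
            pochhammer d (M - k) * pochhammer (A + B + d + x + of_nat k) (M - k) = (\<Sum>i\<le>M - k. ?t k i)"
      by (simp only: pochhammer_add_falling[of "A + B + d + of_nat k" x] sum_distrib_left)
  qed
  also have "\<dots> = (\<Sum>i\<le>M. \<Sum>k\<le>M - i. ?t k i)"
  proof -
    have "(SIGMA k:{..M}. {..M - k}) = {(k, i). k + i \<le> M}" by auto
    then have "(\<Sum>k\<le>M. \<Sum>i\<le>M - k. ?t k i) = (\<Sum>(k, i)\<in>{(k, i). k + i \<le> M}. ?t k i)"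
      by (simp add: sum.Sigma)
    also have "\<dots> = (\<Sum>(i, k)\<in>{(i, k). i + k \<le> M}. ?t k i)"
      by (rule sum.reindex_bij_witness[of _ prod.swap prod.swap]) (auto simp: add.commute)
    also have "{(i, k). i + k \<le> M} = (SIGMA i:{..M}. {..M - i})" by auto
    also have "(\<Sum>(i, k)\<in>(SIGMA i:{..M}. {..M - i}). ?t k i) = (\<Sum>i\<le>M. \<Sum>k\<le>M - i. ?t k i)"
      by (simp add: sum.Sigma)
    finally show ?thesis .
  qed
  also have "\<dots> = (\<Sum>i\<le>M. of_nat (M choose i) * ((- 1) ^ i * pochhammer (- x) i) * pochhammer d i *
            pochhammer (B + d + of_nat i) (M - i) * pochhammer (A + d + of_nat i) (M - i))"
  proof (intro sum.cong refl)
    fix i assume "i \<in> {..M}"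
    then have i: "i \<le> M" by simp
    let ?w = "of_nat (M choose i) * ((- 1) ^ i * pochhammer (- x) i) * pochhammer d i"
    \<comment> \<open>Splitting off \<open>pochhammer d i\<close> shifts d to d + i, and the last
      argument carries the same shift, so the inner sum is again balanced, of length M - i.\<close>
    have "(\<Sum>k\<le>M - i. ?t k i) = (\<Sum>k\<le>M - i. ?w * (of_nat (M - i choose k) * pochhammer A k *
      pochhammer B k * pochhammer (d + of_nat i) (M - i - k) *
      pochhammer (A + B + (d + of_nat i) + of_nat k) (M - i - k)))"
    proof (intro sum.cong refl)
      fix k assume "k \<in> {..M - i}"
      then have ki: "k + i \<le> M" using i by auto
      have "(M choose k) * (M - k choose i) = (M choose i) * (M - i choose k)"
        using choose_mult[of k "k + i" M] choose_mult[of i "k + i" M] ki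
              binomial_symmetric[of k "k + i"] by simp
      then have "(of_nat (M choose k) * of_nat (M - k choose i) :: 'a) =
          of_nat (M choose i) * of_nat (M - i choose k)"
        by (metis of_nat_mult)
      from arg_cong[OF this, of "\<lambda>s. s * (pochhammer A k * pochhammer B k * ((- 1) ^ i *
        pochhammer (- x) i) * pochhammer d i * pochhammer (d + of_nat i) (M - i - k) *
        pochhammer (A + B + (d + of_nat i) + of_nat k) (M - i - k))"]
      have "of_nat (M choose k) * pochhammer A k * pochhammer B k *
          (pochhammer d i * pochhammer (d + of_nat i) (M - i - k)) *
          (of_nat (M - k choose i) * ((- 1) ^ i * pochhammer (- x) i) *
          pochhammer (A + B + (d + of_nat i) + of_nat k) (M - i - k)) =
        ?w * (of_nat (M - i choose k) * pochhammer A k *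
          pochhammer B k * pochhammer (d + of_nat i) (M - i - k) *
          pochhammer (A + B + (d + of_nat i) + of_nat k) (M - i - k))"
        by (simp only: ac_simps)
      moreover have "pochhammer d (M - k) = pochhammer d i * pochhammer (d + of_nat i) (M - i - k)"
        using pochhammer_product'[of d i "M - i - k"] ki by (simp add: add.commute)
      moreover have "A + B + d + of_nat k + of_nat i = A + B + (d + of_nat i) + of_nat k"
        by (simp add: add_ac)
      moreover have "M - k - i = M - i - k" by simp
      ultimately show "?t k i = ?w * (of_nat (M - i choose k) * pochhammer A k *
        pochhammer B k * pochhammer (d + of_nat i) (M - i - k) *
        pochhammer (A + B + (d + of_nat i) + of_nat k) (M - i - k))"
        by (simp only:)
    qed
    also have "\<dots> = ?w * (pochhammer (A + (d + of_nat i)) (M - i) * pochhammer (B + (d + of_nat i)) (M - i))"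
      by (simp only: sum_distrib_left[symmetric] pochhammer_Saalschuetz)
    finally show "(\<Sum>k\<le>M - i. ?t k i) = ?w * pochhammer (B + d + of_nat i) (M - i) *
        pochhammer (A + d + of_nat i) (M - i)"
      by (simp add: add.assoc mult_ac)
  qed
  finally show ?thesis .
qed

section \<open>The quotient of shifted parameters in the falling factorial basis\<close>

text \<open>\<open>fact k * (x choose k)\<close> is the falling factorial of order k, written
  without subtraction. Multiplying it by x gives k times itself plus the next one
  (\<open>rec\<close>), which is the recurrence of the Stirling numbers.\<close>

lemma of_nat_power_Stirling:
  "(of_nat x ^ n :: 'a::comm_semiring_1) = (\<Sum>k\<le>n. of_nat (Stirling n k * fact k * (x choose k)))"
proof (induction n)
  case 0
  show ?case by simp
next
  case (Suc n)
  have rec: "x * (fact k * (x choose k)) = k * (fact k * (x choose k)) + fact (Suc k) * (x choose Suc k)" for k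
  proof (cases "k \<le> x")
    case True
    have "Suc k * (x choose Suc k) = (x - k) * (x choose k)"
      using binomial_absorb_comp[of x k] binomial_absorption[of k x] by simp
    then have "fact (Suc k) * (x choose Suc k) = (x - k) * (fact k * (x choose k))"
      by (metis fact_Suc mult.assoc mult.left_commute of_nat_id)
    then show ?thesis
      using True by (simp flip: add_mult_distrib)
  qed (simp add: binomial_eq_0)
  define B where "B = (\<lambda>k. fact k * (x choose k) :: nat)"
  have "of_nat x ^ Suc n = (\<Sum>k\<le>n. of_nat (Stirling n k * (x * B k)) :: 'a)"
    by (simp add: Suc.IH B_def sum_distrib_left mult_ac)
  also have "\<dots> = (\<Sum>k\<le>n. of_nat (k * Stirling n k * B k)) + (\<Sum>k\<le>n. of_nat (Stirling n k * B (Suc k)))"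
    unfolding B_def rec by (simp add: sum.distrib algebra_simps)
  \<comment> \<open>The added term vanishes since \<open>Stirling n (Suc n)\<close> is 0, and the
    factor k kills the term k = 0, so the index can be shifted to match the other sum.\<close>
  also have "(\<Sum>k\<le>n. of_nat (k * Stirling n k * B k) :: 'a) =
      (\<Sum>k\<le>Suc n. of_nat (k * Stirling n k * B k))"
    by simp
  also have "\<dots> = (\<Sum>k\<le>n. of_nat (Suc k * Stirling n (Suc k) * B (Suc k)))"
    by (subst sum.atMost_Suc_shift) simp
  also have "\<dots> + (\<Sum>k\<le>n. of_nat (Stirling n k * B (Suc k))) =
      (\<Sum>k\<le>n. of_nat (Stirling (Suc n) (Suc k) * B (Suc k)))"
    by (simp add: sum.distrib algebra_simps)
  also have "\<dots> = (\<Sum>k\<le>Suc n. of_nat (Stirling (Suc n) k * B k))"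
    by (subst sum.atMost_Suc_shift) simp
  finally show ?case
    by (simp add: B_def mult.assoc)
qed

lemma degree_pochhammer_linear_le: "degree (pochhammer [:f, 1:] n) \<le> n"
  for f :: "'a::comm_ring_1"
proof (induction n)
  case (Suc n)
  have "degree ([:f, 1:] + of_nat n) \<le> 1"
    by (intro degree_add_le) auto
  then show ?case
    using Suc degree_mult_le[of "[:f, 1:] + of_nat n" "pochhammer [:f, 1:] n"]
    by (simp add: pochhammer_rec')
qed simp

text \<open>Splitting (f)_(m+k) in two ways gives (f)_m (f+m)_k = (f)_k (f+k)_m, which trades a
  quotient of symbols of order k for a polynomial in k of fixed degree.\<close>

lemma pochs_shift_params_quotient:
  assumes "length fs = length ms" and "\<forall>f\<in>set fs. f \<notin> \<int>\<^sub>\<le>\<^sub>0"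
  shows "pochs (shift_params fs ms) k / pochs fs k =
    poly (\<Prod>(f, m)\<leftarrow>zip fs ms. pochhammer [:f, 1:] m) (of_nat k) / Lambda fs ms"
  using assms
proof (induction fs ms rule: list_induct2)
  case (Cons f fs m ms)
  have nz: "pochhammer f n \<noteq> 0" for n
    using Cons.prems by (auto simp: pochhammer_eq_0_iff)
  have "pochhammer f m * pochhammer (f + of_nat m) k = pochhammer f k * pochhammer (f + of_nat k) m"
    by (metis add.commute pochhammer_product')
  then have "pochhammer (f + of_nat m) k / pochhammer f k = pochhammer (f + of_nat k) m / pochhammer f m"
    using nz by (simp add: field_simps)
  moreover have "pochs (shift_params fs ms) k / pochs fs k =
      poly (\<Prod>(f, m)\<leftarrow>zip fs ms. pochhammer [:f, 1:] m) (of_nat k) / Lambda fs ms"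
    using Cons by simp
  ultimately have "(pochhammer (f + of_nat m) k / pochhammer f k) * (pochs (shift_params fs ms) k / pochs fs k) =
      (pochhammer (f + of_nat k) m / pochhammer f m) *
      (poly (\<Prod>(f, m)\<leftarrow>zip fs ms. pochhammer [:f, 1:] m) (of_nat k) / Lambda fs ms)"
    by (simp only:)
  then show ?case
    by (simp add: pochs_def shift_params_def Lambda_def poly_pochhammer_poly)
qed (simp add: pochs_def shift_params_def Lambda_def)

lemma degree_prod_pochhammer_le:
  fixes fs :: "complex list"
  shows "degree (\<Prod>(f, m)\<leftarrow>zip fs ms. pochhammer [:f, 1:] m) \<le> sum_list ms"
proof (induction fs arbitrary: ms)
  case (Cons f fs ms)
  show ?case
  proof (cases ms)
    case (Cons m ms')
    then show ?thesis
      using degree_pochhammer_linear_le[of f m] Cons.IH[of ms']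
            degree_mult_le[of "pochhammer [:f, 1:] m" "\<Prod>(f, m)\<leftarrow>zip fs ms'. pochhammer [:f, 1:] m"]
      by simp
  qed simp
qed simp

text \<open>The Stirling numbers change the basis from the monomials, whose coefficients are
  \<open>sigma\<close>, to falling factorials; exchanging the sums collects the coefficients into
  \<open>C_coeff\<close>.\<close>

lemma pochs_shift_params_expansion:
  assumes "length fs = length ms" and "\<forall>f\<in>set fs. f \<notin> \<int>\<^sub>\<le>\<^sub>0"
  shows "pochs (shift_params fs ms) k / pochs fs k =
    (\<Sum>i\<le>sum_list ms. C_coeff fs ms i * of_nat (fact i * (k choose i)))"
proof -
  define p where "p = (\<Prod>(f, m)\<leftarrow>zip fs ms. pochhammer [:f, 1:] m)"
  define m where "m = sum_list ms"
  define B where "B = (\<lambda>i. of_nat (fact i * (k choose i)) :: complex)"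
  have sig: "coeff p j = sigma fs ms j" for j
    by (simp add: p_def sigma_def)
  have "degree p \<le> m"
    unfolding p_def m_def by (rule degree_prod_pochhammer_le)
  then have "poly p (of_nat k) = (\<Sum>j\<le>m. sigma fs ms j * of_nat k ^ j)"
    unfolding poly_altdef sig[symmetric]
    by (intro sum.mono_neutral_left) (auto simp: coeff_eq_0)
  also have "\<dots> = (\<Sum>j\<le>m. \<Sum>i\<le>m. sigma fs ms j * (of_nat (Stirling j i) * B i))"
  proof (intro sum.cong refl)
    fix j assume "j \<in> {..m}"
    \<comment> \<open>The range is stretched from j to the common bound m, because
      \<open>Stirling j i\<close> is 0 for i > j; the same fact later restricts j to i..m.\<close>
    then have "(of_nat k ^ j :: complex) = (\<Sum>i\<le>m. of_nat (Stirling j i) * B i)"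
      unfolding of_nat_power_Stirling B_def
      by (intro sum.mono_neutral_cong_left) (auto simp: mult.assoc)
    then show "sigma fs ms j * of_nat k ^ j = (\<Sum>i\<le>m. sigma fs ms j * (of_nat (Stirling j i) * B i))"
      by (simp add: sum_distrib_left)
  qed
  also have "\<dots> = (\<Sum>i\<le>m. (\<Sum>j\<le>m. sigma fs ms j * of_nat (Stirling j i)) * B i)"
    by (subst sum.swap) (simp add: sum_distrib_right mult.assoc)
  also have "\<dots> = (\<Sum>i\<le>m. (\<Sum>j=i..m. sigma fs ms j * of_nat (Stirling j i)) * B i)"
    by (intro sum.cong refl arg_cong2[of _ _ _ _ "(*)"] sum.mono_neutral_right) auto
  finally have "poly p (of_nat k) / Lambda fs ms = (\<Sum>i\<le>m. C_coeff fs ms i * B i)"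
    by (simp add: C_coeff_def m_def[symmetric] sum_divide_distrib[of _ "{..m}"])
  then show ?thesis
    unfolding pochs_shift_params_quotient[OF assms] p_def[symmetric] by (simp add: m_def B_def)
qed

section \<open>The finite identity for each antidiagonal\<close>

text \<open>The falling factorial of order i removes the terms k < i. Shifting k by i leaves a
  Sheppard sum for a + i, b + i and M = N - i, whose transform is the terminating series
  \<open>G_poly\<close> at -N without denominators. For N < i both sides vanish.\<close>

lemma binomial_pochhammer_sum_eq_G_poly:
  fixes a b c :: complex and m :: nat
  defines "u \<equiv> c - a - of_nat m" and "v \<equiv> c - b - of_nat m" and "d \<equiv> c - a - b - of_nat m"
  assumes "i \<le> m" "pochhammer u m \<noteq> 0" "pochhammer v m \<noteq> 0"
  shows "(\<Sum>k\<le>N. of_nat (N choose k) * of_nat (fact i * (k choose i)) * pochhammer a k * pochhammer b k *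
            pochhammer d (N - k) * pochhammer (c + of_nat k) (N - k)) =
    pochhammer u N * pochhammer v N *
      ((- 1) ^ i * pochhammer a i * pochhammer b i / (pochhammer u i * pochhammer v i) *
       (pochhammer (- of_nat N) i * poly (G_poly a b c m i) (- of_nat N)))"
proof (cases "i \<le> N")
  case False
  then have "k < i" if "k \<le> N" for k
    using that by simp
  then have "(\<Sum>k\<le>N. of_nat (N choose k) * of_nat (fact i * (k choose i)) * pochhammer a k * pochhammer b k *
            pochhammer d (N - k) * pochhammer (c + of_nat k) (N - k)) = 0"
    by (intro sum.neutral) (auto simp: binomial_eq_0)
  moreover have "pochhammer (- of_nat N) i = (0 :: complex)"
    using False by (intro pochhammer_of_nat_eq_0_lemma) simp
  ultimately show ?thesis by simp
next
  case True
  define M where "M = N - i"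
  define n where "n = m - i"
  have N: "N = i + M" and m: "m = i + n"
    using True \<open>i \<le> m\<close> by (auto simp: M_def n_def)
  have neg_fact: "(- 1) ^ j * pochhammer (- of_nat K) j = (of_nat (fact j * (K choose j)) :: complex)" for j K
    using gbinomial_pochhammer[of "of_nat K :: complex" j] by (simp add: binomial_gbinomial field_simps)
  have u_nz: "pochhammer u i \<noteq> 0" "pochhammer (u + of_nat i) j \<noteq> 0" if "j \<le> n" for j
    using assms(5) that pochhammer_product'[of u i n] pochhammer_neq_0_mono[of "u + of_nat i" n j]
    by (auto simp: m)
  have v_nz: "pochhammer v i \<noteq> 0" "pochhammer (v + of_nat i) j \<noteq> 0" if "j \<le> n" for j
    using assms(6) that pochhammer_product'[of v i n] pochhammer_neq_0_mono[of "v + of_nat i" n j]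
    by (auto simp: m)
  have G: "pochhammer (u + of_nat i) M * pochhammer (v + of_nat i) M * poly (G_poly a b c m i) (- of_nat N) =
    (\<Sum>j\<le>M. of_nat (M choose j) * ((- 1) ^ j * pochhammer (- of_nat n) j) * pochhammer d j *
      pochhammer (u + of_nat i + of_nat j) (M - j) * pochhammer (v + of_nat i + of_nat j) (M - j))"
    (is "_ = (\<Sum>j\<le>M. ?r j)")
  proof -
    let ?g = "\<lambda>j. pochhammer (- of_nat n) j * pochhammer d j /
      (pochhammer (u + of_nat i) j * pochhammer (v + of_nat i) j * fact j) * pochhammer (- of_nat M) j"
    let ?K = "pochhammer (u + of_nat i) M * pochhammer (v + of_nat i) M"
    have "poly (G_poly a b c m i) (- of_nat N) = (\<Sum>j\<le>n. ?g j)"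
      by (simp add: G_poly_def poly_sum poly_pochhammer_poly N m u_def v_def d_def add_ac)
    \<comment> \<open>The series terminates both through -n and through -M. Cutting at the minimum
      keeps j \<le> n, where the denominators are known to be nonzero, and j \<le> M, where (u+i)_M
      splits at j.\<close>
    also have "\<dots> = (\<Sum>j\<le>min n M. ?g j)"
      by (intro sum.mono_neutral_right) (auto simp: pochhammer_of_nat_eq_0_lemma)
    finally have "?K * poly (G_poly a b c m i) (- of_nat N) = (\<Sum>j\<le>min n M. ?K * ?g j)"
      by (simp add: sum_distrib_left)
    also have "\<dots> = (\<Sum>j\<le>min n M. ?r j)"
    proof (intro sum.cong refl)
      fix j assume "j \<in> {..min n M}"
      then have j: "j \<le> n" "j \<le> M" by auto
      have "pochhammer (- of_nat M) j = (- 1) ^ j * (fact j * of_nat (M choose j) :: complex)"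
        using neg_fact[of j M] by (metis left_minus_one_mult_self of_nat_fact of_nat_mult)
      then show "?K * ?g j = ?r j"
        using u_nz(2)[OF j(1)] v_nz(2)[OF j(1)]
        by (simp add: pochhammer_product[OF j(2), of "u + of_nat i"]
              pochhammer_product[OF j(2), of "v + of_nat i"] field_simps)
    qed
    also have "\<dots> = (\<Sum>j\<le>M. ?r j)"
      by (intro sum.mono_neutral_left) (auto simp: pochhammer_of_nat_eq_0_lemma)
    finally show ?thesis .
  qed
  let ?W = "of_nat (fact i * (N choose i)) * pochhammer a i * pochhammer b i"
  \<comment> \<open>This is the Sheppard summand with x = n = m - i: since d = c - a - b - m, its
    last argument is c + i + k.\<close>
  let ?s = "\<lambda>k. of_nat (M choose k) * pochhammer (a + of_nat i) k * pochhammer (b + of_nat i) k *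
    pochhammer d (M - k) * pochhammer ((a + of_nat i) + (b + of_nat i) + d + of_nat n + of_nat k) (M - k)"
  let ?f = "\<lambda>k. of_nat (N choose k) * of_nat (fact i * (k choose i)) * pochhammer a k * pochhammer b k *
            pochhammer d (N - k) * pochhammer (c + of_nat k) (N - k)"
  have "(\<Sum>k\<le>N. ?f k) = (\<Sum>k=i..N. ?f k)"
    by (intro sum.mono_neutral_right) auto
  also have "\<dots> = (\<Sum>k\<le>M. ?f (i + k))"
    by (rule sum.reindex_bij_witness[of _ "\<lambda>k. i + k" "\<lambda>k. k - i"]) (auto simp: N)
  also have "\<dots> = (\<Sum>k\<le>M. ?W * ?s k)"
  proof (intro sum.cong refl)
    fix k assume "k \<in> {..M}"
    then have k: "k \<le> M" by simp
    have "(N choose (i + k)) * (i + k choose i) = (N choose i) * (M choose k)"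
      using choose_mult[of i "i + k" N] k by (simp add: N)
    then have binom: "of_nat (N choose (i + k)) * of_nat (fact i * (i + k choose i)) =
        (of_nat (fact i * (N choose i)) * of_nat (M choose k) :: complex)"
      by (simp only: of_nat_mult[symmetric]) (simp add: mult.left_commute)
    have arg: "(a + of_nat i) + (b + of_nat i) + d + of_nat n + of_nat k = c + of_nat (i + k)"
      by (simp add: d_def m)
    have Nk: "N - (i + k) = M - k" by (simp add: N)
    let ?R = "pochhammer a i * pochhammer (a + of_nat i) k * (pochhammer b i * pochhammer (b + of_nat i) k) *
      pochhammer d (M - k) * pochhammer (c + of_nat (i + k)) (M - k)"
    have "?f (i + k) = of_nat (N choose (i + k)) * of_nat (fact i * (i + k choose i)) * ?R"
      by (simp only: pochhammer_product' Nk mult_ac)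
    also have "\<dots> = of_nat (fact i * (N choose i)) * of_nat (M choose k) * ?R"
      by (simp only: binom)
    also have "\<dots> = ?W * ?s k"
      by (simp only: arg mult_ac)
    finally show "?f (i + k) = ?W * ?s k" .
  qed
  also have "\<dots> = ?W * (pochhammer (u + of_nat i) M * pochhammer (v + of_nat i) M *
      poly (G_poly a b c m i) (- of_nat N))"
  proof -
    have "(b + of_nat i) + d = u + of_nat i" "(a + of_nat i) + d = v + of_nat i"
      by (simp_all add: d_def u_def v_def)
    then show ?thesis
      unfolding sum_distrib_left[symmetric] pochhammer_Sheppard G by (simp only:)
  qed
  also have "of_nat (fact i * (N choose i)) = (- 1) ^ i * (pochhammer (- of_nat N) i :: complex)"
    by (simp only: neg_fact)
  finally show ?thesis
    using u_nz(1)[of 0] v_nz(1)[of 0] by (simp add: N pochhammer_product' del: of_nat_add)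
qed

lemma pochs_Nil [simp]: "pochs [] k = 1"
  and pochs_Cons [simp]: "pochs (x # xs) k = pochhammer x k * pochs xs k"
  and pochs_append [simp]: "pochs (xs @ ys) k = pochs xs k * pochs ys k"
  by (simp_all add: pochs_def)

text \<open>Multiplying by (c)_N N! produces binomial coefficients and (c+k)_(N-k). After expanding
  the parameter quotient, the i-th falling factorial contributes the i-th summand of
  \<open>Q_hat\<close> at -N.\<close>

lemma antidiagonal_sum_eq_Q_hat:
  fixes a b c :: complex and m N :: nat
  defines "u \<equiv> c - a - of_nat m" and "v \<equiv> c - b - of_nat m" and "d \<equiv> c - a - b - of_nat m"
  assumes "length fs = length ms" "m = sum_list ms"
    and "\<forall>f\<in>set fs. f \<notin> \<int>\<^sub>\<le>\<^sub>0" "c \<notin> \<int>\<^sub>\<le>\<^sub>0"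
    and "pochhammer u m \<noteq> 0" "pochhammer v m \<noteq> 0"
  shows "(\<Sum>k\<le>N. pochhammer a k * pochhammer b k * (pochs (shift_params fs ms) k / pochs fs k) *
             pochhammer d (N - k) / (pochhammer c k * (fact k * fact (N - k)))) =
    pochhammer u N * pochhammer v N / (pochhammer c N * fact N) * poly (Q_hat fs ms a b c) (- of_nat N)"
proof -
  have c_nz: "pochhammer c k \<noteq> 0" for k
    using assms(7) by (auto simp: pochhammer_eq_0_iff)
  let ?e = "\<lambda>k. pochhammer a k * pochhammer b k * pochhammer d (N - k) * pochhammer (c + of_nat k) (N - k)"
  have "pochhammer c N * fact N * (\<Sum>k\<le>N. pochhammer a k * pochhammer b k *
      (pochs (shift_params fs ms) k / pochs fs k) *
             pochhammer d (N - k) / (pochhammer c k * (fact k * fact (N - k)))) =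
    (\<Sum>k\<le>N. of_nat (N choose k) * (pochs (shift_params fs ms) k / pochs fs k) * ?e k)"
    unfolding sum_distrib_left
  proof (intro sum.cong refl)
    fix k assume "k \<in> {..N}"
    then have k: "k \<le> N" by simp
    then show "pochhammer c N * fact N * (pochhammer a k * pochhammer b k *
      (pochs (shift_params fs ms) k / pochs fs k) *
             pochhammer d (N - k) / (pochhammer c k * (fact k * fact (N - k)))) =
      of_nat (N choose k) * (pochs (shift_params fs ms) k / pochs fs k) * ?e k"
      using c_nz[of k] by (simp add: binomial_fact pochhammer_product[OF k, of c] mult_ac)
  qed
  also have "\<dots> = (\<Sum>k\<le>N. \<Sum>i\<le>m. C_coeff fs ms i *
      (of_nat (N choose k) * of_nat (fact i * (k choose i)) * pochhammer a k * pochhammer b k *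
        pochhammer d (N - k) * pochhammer (c + of_nat k) (N - k)))"
    unfolding pochs_shift_params_expansion[OF assms(4,6)] assms(5) sum_distrib_left sum_distrib_right
    by (simp only: mult_ac)
  also have "\<dots> = (\<Sum>i\<le>m. C_coeff fs ms i * (\<Sum>k\<le>N.
      of_nat (N choose k) * of_nat (fact i * (k choose i)) * pochhammer a k * pochhammer b k *
        pochhammer d (N - k) * pochhammer (c + of_nat k) (N - k)))"
    by (subst sum.swap) (simp only: sum_distrib_left)
  also have "\<dots> = (\<Sum>i\<le>m. C_coeff fs ms i * (pochhammer u N * pochhammer v N *
      ((- 1) ^ i * pochhammer a i * pochhammer b i / (pochhammer u i * pochhammer v i) *
       (pochhammer (- of_nat N) i * poly (G_poly a b c m i) (- of_nat N)))))"
  proof (intro sum.cong refl)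
    fix i assume "i \<in> {..m}"
    then show "C_coeff fs ms i * (\<Sum>k\<le>N. of_nat (N choose k) * of_nat (fact i * (k choose i)) *
          pochhammer a k * pochhammer b k * pochhammer d (N - k) * pochhammer (c + of_nat k) (N - k)) =
        C_coeff fs ms i * (pochhammer u N * pochhammer v N *
          ((- 1) ^ i * pochhammer a i * pochhammer b i / (pochhammer u i * pochhammer v i) *
           (pochhammer (- of_nat N) i * poly (G_poly a b c m i) (- of_nat N))))"
      using binomial_pochhammer_sum_eq_G_poly[OF _ assms(8,9)[unfolded u_def v_def], of i N]
      unfolding u_def v_def d_def atMost_iff by (simp only: simp_thms)
  qed
  also have "\<dots> = pochhammer u N * pochhammer v N * poly (Q_hat fs ms a b c) (- of_nat N)"
    by (simp add: Q_hat_def Let_def poly_sum poly_pochhammer_poly sum_distrib_left u_def v_def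
          mult_ac flip: assms(5))
  finally show ?thesis
    using c_nz[of N] by (simp add: field_simps)
qed

lemma pochs_0 [simp]: "pochs xs 0 = 1"
  by (induction xs) simp_all

section \<open>Products over roots and summation along antidiagonals\<close>

text \<open>In p(-z) / p(0) the leading coefficient cancels from the factorization over the roots,
  and so do the signs of the linear factors.\<close>

lemma prod_list_roots_quotient:
  fixes p :: "complex poly"
  assumes "mset rs = proots p" "poly p 0 = 1"
  shows "(\<Prod>r\<leftarrow>rs. (r + z) / r) = poly p (- z)"
proof -
  have dec: "poly p t = lead_coeff p * (\<Prod>r\<leftarrow>rs. t - r)" for t
  proof -
    have "poly p t = poly (smult (lead_coeff p) (\<Prod>r\<in>#mset rs. [:- r, 1:])) t"
      by (simp only: assms(1) complex_poly_decompose_multiset)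
    moreover have "poly (\<Prod>r\<in>#mset rs. [:- r, 1:]) t = (\<Prod>r\<leftarrow>rs. t - r)"
      by (induction rs) (simp_all add: algebra_simps)
    ultimately show ?thesis
      by simp
  qed
  have "(\<Prod>r\<leftarrow>rs. (r + z) / r) = (\<Prod>r\<leftarrow>rs. - z - r) / (\<Prod>r\<leftarrow>rs. 0 - r)"
  proof (induction rs)
    case (Cons r rs)
    \<comment> \<open>For r = 0 both sides are 0, as division by zero gives 0.\<close>
    have "(r + z) / r = (- z - r) / (0 - r)"
      by (simp add: divide_simps)
    then show ?case
      by (simp only: Cons.IH list.map prod_list.Cons times_divide_times_eq)
  qed simp
  also have "\<dots> = poly p (- z) / poly p 0"
  proof -
    have "p \<noteq> 0" using assms(2) by auto
    then show ?thesis
      by (simp only: dec[of "- z"] dec[of 0]) simp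
  qed
  finally show ?thesis
    by (simp add: assms(2))
qed

text \<open>Absolute convergence makes the family of all pairs unconditionally summable, so grouping
  it by rows and by antidiagonals gives the same value S.\<close>

lemma antidiagonal_sums:
  fixes f :: "nat \<Rightarrow> nat \<Rightarrow> 'a::banach"
  assumes "(\<lambda>(k, l). norm (f k l)) summable_on UNIV"
  shows "(\<lambda>n. \<Sum>k\<le>n. f k (n - k)) sums (\<Sum>k. \<Sum>l. f k l)"
proof -
  have "(\<lambda>(k, l). f k l) abs_summable_on UNIV \<times> UNIV"
    using assms by (simp add: case_prod_unfold)
  then have sm: "(\<lambda>(k, l). f k l) summable_on UNIV \<times> UNIV"
    by (rule abs_summable_summable)
  then obtain S where S: "((\<lambda>(k, l). f k l) has_sum S) (UNIV \<times> UNIV)"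
    by (auto simp: summable_on_def)
  have row: "(f k has_sum (\<Sum>l. f k l)) UNIV" for k
  proof -
    have "(\<lambda>(k, l). f k l) summable_on Pair k ` UNIV"
      by (rule summable_on_subset_banach[OF sm]) auto
    then have "f k summable_on UNIV"
      by (simp add: summable_on_reindex inj_on_def o_def)
    then have "(f k has_sum infsum (f k) UNIV) UNIV"
      by (rule has_sum_infsum)
    then show ?thesis
      by (metis has_sum_imp_sums sums_unique)
  qed
  have "((\<lambda>k. \<Sum>l. f k l) has_sum S) UNIV"
    using S by (rule has_sum_SigmaD) (use row in auto)
  then have S_eq: "S = (\<Sum>k. \<Sum>l. f k l)"
    using has_sum_imp_sums sums_unique by blast
  have "bij_betw (\<lambda>(n, k). (k, n - k)) (SIGMA n:UNIV. {..n}) (UNIV \<times> (UNIV :: nat set))"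
    by (rule bij_betwI[of _ _ _ "\<lambda>(k, l). (k + l, k)"]) auto
  from has_sum_reindex_bij_betw[OF this, of "\<lambda>(k, l). f k l"] S
  have "((\<lambda>(n, k). f k (n - k)) has_sum S) (SIGMA n:UNIV. {..n})"
    by (simp add: case_prod_unfold)
  then have "((\<lambda>n. \<Sum>k\<le>n. f k (n - k)) has_sum S) UNIV"
    by (rule has_sum_SigmaD) (auto intro: has_sum_finiteI)
  then show ?thesis
    unfolding S_eq by (rule has_sum_imp_sums)
qed

section \<open>Comparing the two series coefficient by coefficient\<close>

theorem mainTheorem3:
  fixes \<alpha>s \<beta>s fs \<eta>s :: "complex list" and ms :: "nat list" and m :: nat
    and a b c x :: complex
  assumes "length ms = length fs"
    and "\<forall>n\<in>set ms. 0 < n"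
    and "m = sum_list ms"
    and "\<forall>\<beta>\<in>set \<beta>s. \<beta> \<notin> \<int>\<^sub>\<le>\<^sub>0"
    and "c \<notin> \<int>\<^sub>\<le>\<^sub>0"
    and "\<forall>f\<in>set fs. f \<notin> \<int>\<^sub>\<le>\<^sub>0"
    and "pochhammer (c - a - of_nat m) m \<noteq> 0"
    and "pochhammer (c - b - of_nat m) m \<noteq> 0"
    and "degree (Q_hat fs ms a b c) = m"
    and "mset \<eta>s = proots (Q_hat fs ms a b c)"
    and "kdf_abs_convergent
           \<alpha>s ([a, b] @ shift_params fs ms) [c - a - b - of_nat m]
           \<beta>s (c # fs) [] x x"
  shows "summable (hyp_shift_term
           (\<alpha>s @ [c - a - of_nat m, c - b - of_nat m]) (\<beta>s @ [c]) \<eta>s x) \<and>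
         kampe_de_feriet
           \<alpha>s ([a, b] @ shift_params fs ms) [c - a - b - of_nat m]
           \<beta>s (c # fs) [] x x
         = pFq_shift (\<alpha>s @ [c - a - of_nat m, c - b - of_nat m]) (\<beta>s @ [c]) \<eta>s x"
proof -
  let ?t = "kdf_term \<alpha>s ([a, b] @ shift_params fs ms) [c - a - b - of_nat m] \<beta>s (c # fs) [] x x"
  let ?h = "hyp_shift_term (\<alpha>s @ [c - a - of_nat m, c - b - of_nat m]) (\<beta>s @ [c]) \<eta>s x"
  note anti = antidiagonal_sum_eq_Q_hat[OF assms(1)[symmetric] assms(3,6,5,7,8)]
  \<comment> \<open>For N = 0 the finite identity has a single summand, equal to 1.\<close>
  have Q0: "poly (Q_hat fs ms a b c) 0 = 1"
    using anti[of 0] by simp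
  have "(\<Sum>k\<le>N. ?t k (N - k)) = ?h N" for N
  proof -
    let ?X = "pochs \<alpha>s N / pochs \<beta>s N * x ^ N"
    have "(\<Sum>k\<le>N. ?t k (N - k)) = (\<Sum>k\<le>N. ?X * (pochhammer a k * pochhammer b k *
        (pochs (shift_params fs ms) k / pochs fs k) * pochhammer (c - a - b - of_nat m) (N - k) /
        (pochhammer c k * (fact k * fact (N - k)))))"
    proof (intro sum.cong refl)
      fix k assume "k \<in> {..N}"
      then have k: "k + (N - k) = N" by simp
      then have "x ^ k * x ^ (N - k) = x ^ N"
        by (simp flip: power_add)
      then show "?t k (N - k) = ?X * (pochhammer a k * pochhammer b k *
        (pochs (shift_params fs ms) k / pochs fs k) * pochhammer (c - a - b - of_nat m) (N - k) /
        (pochhammer c k * (fact k * fact (N - k))))"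
        unfolding kdf_term_def k by (simp add: mult_ac)
    qed
    also have "\<dots> = ?h N"
      unfolding sum_distrib_left[symmetric] anti hyp_shift_term_def
        prod_list_roots_quotient[OF assms(10) Q0] by (simp add: mult_ac)
    finally show ?thesis .
  qed
  \<comment> \<open>\<open>sums\<close> yields convergence of the right-hand series together with
    its value, so \<open>pFq_shift\<close> denotes a genuine limit.\<close>
  then have "?h sums kampe_de_feriet \<alpha>s ([a, b] @ shift_params fs ms) [c - a - b - of_nat m]
      \<beta>s (c # fs) [] x x"
    using antidiagonal_sums[OF assms(11)[unfolded kdf_abs_convergent_def]]
    by (simp add: kampe_de_feriet_def)
  then show ?thesis
    unfolding pFq_shift_def by (auto simp: sums_iff)
qed

end
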